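(* Let $n\ge2$ and $K>0$. The local isometry moduli space of $n$-dimensional strongly convex Randers spaces of constant flag curvature $K$ is parametrized by $a=(a_1,\dots,a_m)\in\mathbb R^m$ as follows; that is, $a\mapsto[W_a]$ is a bijection from the stated parameter space onto the moduli space. (i) When $n$ is even, $m=n/2$ and the parameter space is given by $a_1\ge\cdots\ge a_m\ge0$. (ii) When $n$ is odd, $m=(n+1)/2$ and the parameter space is given by $a_1\ge\cdots\ge a_m\ge0$ with $\sqrt K>a_m$. (iii) The globally defined metrics on $S^n$ (that is, the classes for which strong convexity $|W|<1$ holds on all of $S^n$) are parametrized by the polytope $\sqrt K>a_1\ge\cdots\ge a_m\ge0$.
   Context: A strongly convex Randers metric is a Finsler metric $F=\sqrt{a_{ij}y^iy^j}+b_iy^i$ with $a^{ij}b_ib_j<1$; it corresponds uniquely to navigation data $(h,W)$, $h$ a Riemannian metric and $W$ a vector field with $|W|^2=h(W,W)<1$, via $a_{ij}=\frac{h_{ij}}\lambda+\frac{W_iW_j}{\lambda^2}$, $b_i=-\frac{W_i}\lambda$, $W_i=h_{ij}W^j$, $\lambda=1-|W|^2$. Constant flag curvature $K>0$ holds exactly when, up to local isometry, $h=h_+$ is $\frac1K$ times the standard metric of the unit sphere $S^n\subset\mathbb R^{n+1}$ and $W$ is a Killing field of $h_+$. The moduli space is defined as follows. Consider all Killing fields $W$ of $(S^n,h_+)$ such that $|W|<1$ (norm with respect to $h_+$) on some nonempty open subset of $S^n$. The isometry group $G=O(n+1)$ of $(S^n,h_+)$ acts by push-forward $W\mapsto\phi_*W$.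 The moduli space is the set of $G$-orbits $[W]$ of such $W$; it represents local isometry classes of strongly convex Randers metrics of constant flag curvature $K$. Killing fields of $(S^n,h_+)$ correspond to skew-symmetric $(n+1)\times(n+1)$ real matrices $\Omega$ by $[W(p)]^t=p^t\,\Omega$, $p\in S^n\subset\mathbb R^{n+1}$ a column vector. With $J=\begin{pmatrix}0&1\\-1&0\end{pmatrix}$, $W_a$ denotes the Killing field corresponding to the block-diagonal matrix $\tilde\Omega=a_1J\oplus\cdots\oplus a_mJ\oplus0$ when $n$ is even ($m=n/2$) and $\tilde\Omega=a_1J\oplus\cdots\oplus a_mJ$ when $n$ is odd ($m=(n+1)/2$). *)

theory Defs
  imports "HOL-Analysis.Analysis"
begin

primrec Ck_on :: "nat \<Rightarrow> 'a::euclidean_space set \<Rightarrow> ('a \<Rightarrow> 'b::real_normed_vector) \<Rightarrow> bool" where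
  "Ck_on 0 U = (\<lambda>f. continuous_on U f)"
| "Ck_on (Suc k) U = (\<lambda>f. f differentiable_on U \<and>
      (\<forall>v. Ck_on k U (\<lambda>x. frechet_derivative f (at x) v)))"

(* Only meaningful for open U, where the derivatives taken at x and at x within U agree. *)
definition smooth_on :: "'a::euclidean_space set \<Rightarrow> ('a \<Rightarrow> 'b::real_normed_vector) \<Rightarrow> bool" where
  "smooth_on U f \<longleftrightarrow> (\<forall>k. Ck_on k U f)"

abbreviation unit_sphere :: "'a::euclidean_space set" where
  "unit_sphere \<equiv> sphere 0 1"

definition tangent_space :: "'a::euclidean_space \<Rightarrow> 'a set" where
  "tangent_space p = {v. p \<bullet> v = 0}"

(* The metric 1/K times the standard one. It is the restriction of a constant bilinear form of
   the ambient space, so the base point is not an argument. *)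
definition sphere_metric :: "real \<Rightarrow> 'a::euclidean_space \<Rightarrow> 'a \<Rightarrow> real" where
  "sphere_metric K u v = (u \<bullet> v) / K"

(* A field on the sphere is a function with value undefined off the sphere, so that equality of
   functions is equality of fields. As the sphere is a closed submanifold, smoothness means
   having a smooth extension to a neighbourhood. *)
definition smooth_vector_field :: "('a::euclidean_space \<Rightarrow> 'a) \<Rightarrow> bool" where
  "smooth_vector_field W \<longleftrightarrow>
     W \<in> extensional unit_sphere \<and>
     (\<forall>p\<in>unit_sphere. W p \<in> tangent_space p) \<and>
     (\<exists>U f. open U \<and> unit_sphere \<subseteq> U \<and> smooth_on U f \<and> (\<forall>p\<in>unit_sphere. f p = W p))"

(* Levi-Civita derivative of W at p in the tangent direction u: differentiate an extension of W
   and project to the tangent space. The extension used is W (x / |x|), since sgn x = x /R norm x;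
   the result does not depend on that choice, nor on the scale of the metric. *)
definition cov_deriv :: "('a::euclidean_space \<Rightarrow> 'a) \<Rightarrow> 'a \<Rightarrow> 'a \<Rightarrow> 'a" where
  "cov_deriv W p u =
     (let D = frechet_derivative (\<lambda>x. W (sgn x)) (at p) u in D - (D \<bullet> p) *\<^sub>R p)"

(* The Killing equation: the Lie derivative of the metric along W vanishes. *)
definition killing_field :: "real \<Rightarrow> ('a::euclidean_space \<Rightarrow> 'a) \<Rightarrow> bool" where
  "killing_field K W \<longleftrightarrow>
     smooth_vector_field W \<and>
     (\<forall>p\<in>unit_sphere. \<forall>u\<in>tangent_space p. \<forall>v\<in>tangent_space p.
        sphere_metric K (cov_deriv W p u) v + sphere_metric K u (cov_deriv W p v) = 0)"

definition strongly_convex_at :: "real \<Rightarrow> ('a::euclidean_space \<Rightarrow> 'a) \<Rightarrow> 'a \<Rightarrow> bool" where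
  "strongly_convex_at K W p \<longleftrightarrow> sqrt (sphere_metric K (W p) (W p)) < 1"

definition pushforward :: "('a::euclidean_space \<Rightarrow> 'a) \<Rightarrow> ('a \<Rightarrow> 'a) \<Rightarrow> ('a \<Rightarrow> 'a)" where
  "pushforward \<phi> W =
     restrict (\<lambda>q. frechet_derivative \<phi> (at (inv \<phi> q)) (W (inv \<phi> q))) unit_sphere"

definition isometry_orbit :: "('a::euclidean_space \<Rightarrow> 'a) \<Rightarrow> ('a \<Rightarrow> 'a) set" where
  "isometry_orbit W = {pushforward \<phi> W | \<phi>. orthogonal_transformation \<phi>}"

definition moduli_space :: "real \<Rightarrow> ('a::euclidean_space \<Rightarrow> 'a) set set" where
  "moduli_space K = isometry_orbit ` {W. killing_field K W \<and>
     (\<exists>U. openin (top_of_set unit_sphere) U \<and> U \<noteq> {} \<and> (\<forall>p\<in>U. strongly_convex_at K W p))}"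

definition global_moduli_space :: "real \<Rightarrow> ('a::euclidean_space \<Rightarrow> 'a) set set" where
  "global_moduli_space K =
     {C \<in> moduli_space K. \<forall>W\<in>C. \<forall>p\<in>unit_sphere. strongly_convex_at K W p}"

definition half_dim :: "nat \<Rightarrow> nat" where
  "half_dim n = (if even n then n div 2 else (n + 1) div 2)"

(* The direct sum of the blocks a_k J, with J = (0 1; -1 0), and of a last zero entry if n is
   even. The index type carries no order; idx numbers its elements 1, ..., n + 1, and block k
   sits at the positions 2k - 1 and 2k. *)
definition block_matrix :: "('d::finite \<Rightarrow> nat) \<Rightarrow> nat \<Rightarrow> (nat \<Rightarrow> real) \<Rightarrow> real^'d^'d" where
  "block_matrix idx n a = (\<chi> r s. \<Sum>k = 1..half_dim n.
     (if idx r = 2 * k - 1 \<and> idx s = 2 * k then a k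
      else if idx r = 2 * k \<and> idx s = 2 * k - 1 then - a k else 0))"

definition normal_form_field ::
  "('d::finite \<Rightarrow> nat) \<Rightarrow> nat \<Rightarrow> (nat \<Rightarrow> real) \<Rightarrow> (real^'d \<Rightarrow> real^'d)" where
  "normal_form_field idx n a = restrict (\<lambda>p. p v* block_matrix idx n a) unit_sphere"

(* Tuples (a 1, ..., a m), as functions with value undefined off {1..m}. *)
definition decreasing_nonneg_tuples :: "nat \<Rightarrow> (nat \<Rightarrow> real) set" where
  "decreasing_nonneg_tuples m =
     {a \<in> {1..m} \<rightarrow>\<^sub>E UNIV. (\<forall>i\<in>{1..m}. \<forall>j\<in>{1..m}. i \<le> j \<longrightarrow> a i \<ge> a j) \<and>
        (\<forall>i\<in>{1..m}. a i \<ge> 0)}"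

end

theory Submission
  imports Defs
begin

text \<open>
  The classification is linear algebra of skew-symmetric maps, once Killing fields are known to be
  linear.

  \<^item> A Killing field of the sphere is the restriction of a skew-symmetric linear map
    (\<open>killing_field_iff_skew\<close>). The component of a Killing field along the velocity of a great
    circle is constant on the circle. Comparing two points \<open>p\<close>, \<open>q\<close> of the circle through
    them gives \<open>W p \<bullet> q = - (W q \<bullet> p)\<close>, and an identity of this kind forces
    linearity, because its right-hand side depends linearly on \<open>p\<close>.

  \<^item> Since a linear map is determined by its values on the sphere, isometry orbits of Killing
    fields are orthogonal conjugacy classes of skew maps (\<open>isometry_orbit_eq_iff\<close>).

  \<^item> Each class contains a block matrix with decreasing nonnegative entries
    (\<open>skew_similar_to_block_map\<close>): one splits off, again and again, a plane on which the map
    stretches the most.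

  \<^item> The entries are invariants of the class (\<open>block_map_similar_imp_eq\<close>): the square of a
    block matrix is diagonal with the negated squared entries on its diagonal, so the dimensions of
    its eigenspaces count how often each value occurs.

  \<^item> On the unit sphere \<open>(norm (W\<^sub>a p))\<^sup>2\<close> is a convex combination of the squared
    entries, each basis vector realising one of them (\<open>block_map_norm_bounds_iff\<close>). Hence strong
    convexity holds somewhere when the least entry is below \<open>sqrt K\<close>, and everywhere when the
    largest one is. The largest is \<open>a\<^sub>1\<close>; the least is \<open>a\<^sub>m\<close> for odd \<open>n\<close>, but
    \<open>0\<close> for even \<open>n\<close>, where one coordinate axis is fixed. This is why the two parities
    have different parameter spaces.
\<close>

section \<open>Killing fields of the sphere are skew linear maps\<close>

definition skew :: "('a::euclidean_space \<Rightarrow> 'a) \<Rightarrow> bool" where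
  "skew S \<longleftrightarrow> linear S \<and> (\<forall>x y. S x \<bullet> y = - (x \<bullet> S y))"

lemma skewD: "skew S \<Longrightarrow> linear S" "skew S \<Longrightarrow> S x \<bullet> y = - (x \<bullet> S y)"
  by (auto simp: skew_def)

lemma skew_inner_self: "skew S \<Longrightarrow> S x \<bullet> x = 0"
  using skewD(2)[of S x x] by (simp add: inner_commute)

lemma Ck_on_const: "Ck_on k U (\<lambda>x. c)"
  by (induction k arbitrary: c) (auto)

lemma smooth_on_linear:
  assumes "linear f"
  shows "smooth_on UNIV f"
proof -
  have d: "(f has_derivative f) (at x)" for x
    by (simp add: assms linear_imp_has_derivative)
  have "Ck_on k UNIV f" for k
  proof (cases k)
    case 0
    then show ?thesis
      using assms by (simp add: linear_continuous_on linear_conv_bounded_linear)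
  next
    case (Suc l)
    have "frechet_derivative f (at x) = f" for x
      using frechet_derivative_at[OF d] by simp
    then show ?thesis
      using d by (auto simp: Suc Ck_on_const differentiable_on_def differentiable_def)
  qed
  then show ?thesis by (simp add: smooth_on_def)
qed

lemma has_derivative_sgn_unit:
  fixes p :: "'a::euclidean_space"
  assumes "p \<in> unit_sphere"
  shows "(sgn has_derivative (\<lambda>h. h - (p \<bullet> h) *\<^sub>R p)) (at p)"
proof -
  have n: "norm p = 1" and p: "p \<noteq> 0" "sgn p = p" using assms by (auto simp: sgn_div_norm)
  have "((\<lambda>x. inverse (norm x) *\<^sub>R x) has_derivative
      (\<lambda>h. inverse (norm p) *\<^sub>R h + (- (inverse (norm p) * (sgn p \<bullet> h) * inverse (norm p))) *\<^sub>R p)) (at p)"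
    using p by (auto intro!: derivative_eq_intros has_derivative_norm simp: inner_commute)
  then show ?thesis
    by (simp add: n p sgn_div_norm[abs_def])
qed

lemma cov_deriv_skew:
  fixes S :: "'a::euclidean_space \<Rightarrow> 'a"
  assumes S: "skew S" and p: "p \<in> unit_sphere" and u: "u \<in> tangent_space p"
  shows "cov_deriv (restrict S unit_sphere) p u = S u - (S u \<bullet> p) *\<^sub>R p"
proof -
  have "p \<noteq> 0" "sgn p = p" using p by (auto simp: sgn_div_norm)
  have "((\<lambda>x. S (sgn x)) has_derivative (\<lambda>h. S (h - (p \<bullet> h) *\<^sub>R p))) (at p)"
    by (rule has_derivative_compose[OF has_derivative_sgn_unit[OF p]])
      (simp add: \<open>sgn p = p\<close> skewD(1)[OF S] linear_imp_has_derivative)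
  then have "((\<lambda>x. restrict S unit_sphere (sgn x)) has_derivative
      (\<lambda>h. S (h - (p \<bullet> h) *\<^sub>R p))) (at p)"
    by (rule has_derivative_transform_within_open[of _ _ _ _ "- {0}"])
      (use \<open>p \<noteq> 0\<close> in \<open>auto simp: norm_sgn\<close>)
  from frechet_derivative_at[OF this, symmetric] u show ?thesis
    by (simp add: cov_deriv_def tangent_space_def Let_def del: restrict_apply)
qed

lemma killing_field_skew:
  fixes S :: "'a::euclidean_space \<Rightarrow> 'a"
  assumes S: "skew S"
  shows "killing_field K (restrict S unit_sphere)"
proof -
  have "smooth_vector_field (restrict S unit_sphere)"
    unfolding smooth_vector_field_def tangent_space_def
    using smooth_on_linear[OF skewD(1)[OF S]] skew_inner_self[OF S]
    by (auto simp: inner_commute intro!: exI[of _ UNIV] exI[of _ S])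
  moreover have "sphere_metric K (cov_deriv (restrict S unit_sphere) p u) v
      + sphere_metric K u (cov_deriv (restrict S unit_sphere) p v) = 0"
    if "p \<in> unit_sphere" "u \<in> tangent_space p" "v \<in> tangent_space p" for p u v
    using that skewD(2)[OF S, of u v] unfolding sphere_metric_def
    by (simp add: cov_deriv_skew[OF S] inner_diff_left inner_diff_right tangent_space_def
        inner_commute flip: add_divide_distrib)
  ultimately show ?thesis by (simp add: killing_field_def)
qed

text \<open>
  The projection to the tangent space in the covariant derivative is invisible when it is paired
  with a tangent vector, so the Killing equation says that the derivative \<open>D\<close> of the radial
  extension is skew on the tangent space. The diagonal case below is all that great circles need.
\<close>
lemma killing_field_derivative:
  fixes W :: "'a::euclidean_space \<Rightarrow> 'a"
  assumes W: "killing_field K W" and K: "K \<noteq> 0" and p: "p \<in> unit_sphere"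
  obtains D where "((\<lambda>x. W (sgn x)) has_derivative D) (at p)" "\<And>u. u \<bullet> p = 0 \<Longrightarrow> D u \<bullet> u = 0"
proof -
  obtain U f where U: "open U" "unit_sphere \<subseteq> U" "smooth_on U f" "\<And>p. p \<in> unit_sphere \<Longrightarrow> f p = W p"
    using W unfolding killing_field_def smooth_vector_field_def by blast
  have "p \<noteq> 0" "sgn p = p" using p by (auto simp: sgn_div_norm)
  have "f differentiable_on U"
    using U(3) unfolding smooth_on_def by (metis Ck_on.simps(2))
  then have "f differentiable (at (sgn p))"
    using U p \<open>sgn p = p\<close> by (metis at_within_open differentiable_on_def subsetD)
  then obtain D' where "(f has_derivative D') (at (sgn p))" by (auto simp: differentiable_def)
  from has_derivative_compose[OF has_derivative_sgn_unit[OF p] this]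
  obtain D where "((\<lambda>x. f (sgn x)) has_derivative D) (at p)" by blast
  then have D: "((\<lambda>x. W (sgn x)) has_derivative D) (at p)"
    by (rule has_derivative_transform_within_open[of _ _ _ _ "- {0}"])
      (use \<open>p \<noteq> 0\<close> U(4) in \<open>auto simp: norm_sgn\<close>)
  have "D u \<bullet> u = 0" if "u \<bullet> p = 0" for u
  proof -
    have "u \<in> tangent_space p" using that by (simp add: tangent_space_def inner_commute)
    then have "sphere_metric K (cov_deriv W p u) u + sphere_metric K u (cov_deriv W p u) = 0"
      using W p unfolding killing_field_def by blast
    then have "cov_deriv W p u \<bullet> u = 0"
      using K by (simp add: sphere_metric_def inner_commute[of u])
    moreover have "cov_deriv W p u = D u - (D u \<bullet> p) *\<^sub>R p"
      by (simp add: cov_deriv_def Let_def flip: frechet_derivative_at[OF D])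
    ultimately show ?thesis
      using that by (simp add: inner_diff_left inner_commute[of p])
  qed
  with D that show thesis by blast
qed

text \<open>
  Clairaut's relation. Along the great circle \<open>c\<close> the derivative of \<open>W c \<bullet> c'\<close> has two
  terms: \<open>D c' \<bullet> c'\<close> vanishes by the Killing equation, and \<open>W c \<bullet> c''\<close> vanishes since
  \<open>c'' = - c\<close> is normal to the sphere.
\<close>
lemma killing_field_great_circle:
  fixes W :: "'a::euclidean_space \<Rightarrow> 'a"
  assumes W: "killing_field K W" and K: "K \<noteq> 0"
    and p: "norm p = 1" and u: "norm u = 1" and pu: "p \<bullet> u = 0"
  shows "W (cos t *\<^sub>R p + sin t *\<^sub>R u) \<bullet> (cos t *\<^sub>R u - sin t *\<^sub>R p) = W p \<bullet> u"
proof -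
  define c c' where "c t = cos t *\<^sub>R p + sin t *\<^sub>R u"
    and "c' t = cos t *\<^sub>R u - sin t *\<^sub>R p" for t
  have pp: "p \<bullet> p = 1" and uu: "u \<bullet> u = 1" and up: "u \<bullet> p = 0"
    using p u pu by (auto simp: dot_square_norm inner_commute)
  have c: "c t \<in> unit_sphere" for t
  proof -
    have "c t \<bullet> c t = (cos t)\<^sup>2 + (sin t)\<^sup>2"
      by (simp add: c_def inner_add_left inner_add_right pp uu up pu power2_eq_square)
    then show ?thesis by (simp add: norm_eq_sqrt_inner)
  qed
  have cc': "c' t \<bullet> c t = 0" for t
    by (simp add: c_def c'_def inner_add_left inner_add_right inner_diff_left pp uu up pu)
  have dc: "(c has_derivative (\<lambda>s. s *\<^sub>R c' t)) (at t)" for t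
    unfolding c_def c'_def by (auto intro!: derivative_eq_intros simp: algebra_simps)
  have dc': "(c' has_derivative (\<lambda>s. s *\<^sub>R (- c t))) (at t)" for t
    unfolding c_def c'_def by (auto intro!: derivative_eq_intros simp: algebra_simps)
  have "((\<lambda>t. W (sgn (c t)) \<bullet> c' t) has_derivative (\<lambda>_. 0)) (at t)" for t
  proof -
    obtain D where D: "((\<lambda>x. W (sgn x)) has_derivative D) (at (c t))"
      and DD: "\<And>u. u \<bullet> c t = 0 \<Longrightarrow> D u \<bullet> u = 0"
      using killing_field_derivative[OF W K c] by metis
    have sg: "sgn (c t) = c t" using c[of t] by (simp add: sgn_div_norm)
    have Wc: "c t \<bullet> W (c t) = 0"
      using W c[of t] by (auto simp: killing_field_def smooth_vector_field_def tangent_space_def)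
    have lin: "D (s *\<^sub>R x) = s *\<^sub>R D x" for s x
      using D by (simp add: has_derivative_linear linear_scale)
    have "((\<lambda>t. W (sgn (c t))) has_derivative (\<lambda>s. D (s *\<^sub>R c' t))) (at t)"
      by (rule has_derivative_compose[OF dc D])
    from has_derivative_inner[OF this dc'] show ?thesis
      by (simp add: sg Wc lin DD[OF cc'] inner_commute[of "W _" "c _"])
  qed
  then have "W (sgn (c t)) \<bullet> c' t = W (sgn (c 0)) \<bullet> c' 0"
    using has_derivative_zero_unique_connected[of UNIV "\<lambda>t. W (sgn (c t)) \<bullet> c' t" t 0] by simp
  moreover have "sgn (c t) = c t" for t using c[of t] by (simp add: sgn_div_norm)
  ultimately have "W (c t) \<bullet> c' t = W (c 0) \<bullet> c' 0" by simp
  then show ?thesis by (simp add: c_def c'_def)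
qed

text \<open>
  Write \<open>q = cos t p + sin t u\<close> with \<open>u\<close> a unit vector orthogonal to \<open>p\<close>. Clairaut's
  relation between \<open>p\<close> and \<open>q\<close>, together with tangency of \<open>W q\<close>, is a linear system for the
  two components of \<open>W q\<close> in the plane of \<open>p\<close> and \<open>u\<close>.
\<close>
lemma killing_field_inner:
  fixes W :: "'a::euclidean_space \<Rightarrow> 'a"
  assumes W: "killing_field K W" and K: "K \<noteq> 0"
    and p: "norm p = 1" and q: "norm q = 1"
  shows "W p \<bullet> q = - (W q \<bullet> p)"
proof -
  have tan: "W x \<bullet> x = 0" if "norm x = 1" for x
    using W that by (auto simp: killing_field_def smooth_vector_field_def tangent_space_def inner_commute)
  define v where "v = q - (p \<bullet> q) *\<^sub>R p"
  have pp: "p \<bullet> p = 1" and qq: "q \<bullet> q = 1" using p q by (auto simp: dot_square_norm)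
  have pv: "p \<bullet> v = 0" by (simp add: v_def inner_diff_right pp)
  show ?thesis
  proof (cases "v = 0")
    \<comment> \<open>Here \<open>q = p\<close> or \<open>q = - p\<close>, and no great circle is singled out; both sides vanish by tangency.\<close>
    case True
    then have qp: "q = (p \<bullet> q) *\<^sub>R p" by (simp add: v_def)
    have 1: "W p \<bullet> q = 0" by (subst qp) (simp add: tan[OF p])
    have "(p \<bullet> q) * (p \<bullet> q) = 1" using qq arg_cong[OF qp, of "\<lambda>x. x \<bullet> q"] by simp
    moreover have "(p \<bullet> q) * (W q \<bullet> p) = 0"
      using tan[OF q] arg_cong[OF qp, of "\<lambda>x. W q \<bullet> x"] by simp
    ultimately show ?thesis using 1 by auto
  next
    case False
    define u where "u = sgn v"
    have u: "norm u = 1" "p \<bullet> u = 0" using False pv by (auto simp: u_def norm_sgn sgn_div_norm)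
    have vu: "v = norm v *\<^sub>R u" using False by (simp add: u_def sgn_div_norm)
    have "v \<bullet> v = 1 - (p \<bullet> q)\<^sup>2"
      by (simp add: v_def inner_diff_left inner_diff_right pp qq inner_commute power2_eq_square)
    then have "(p \<bullet> q)\<^sup>2 + (norm v)\<^sup>2 = 1" by (simp add: dot_square_norm)
    then obtain t where t: "p \<bullet> q = cos t" "norm v = sin t"
      using sincos_total_2pi_le by metis
    have q': "q = cos t *\<^sub>R p + sin t *\<^sub>R u" using vu by (simp add: v_def flip: t)
    have a: "W q \<bullet> (cos t *\<^sub>R u - sin t *\<^sub>R p) = W p \<bullet> u"
      using killing_field_great_circle[OF W K p u, of t] by (simp add: q')
    have b: "W q \<bullet> (cos t *\<^sub>R p + sin t *\<^sub>R u) = 0" using tan[OF q] q' by simp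
    have solve: "X = - (s * Z)" if "c * Y - s * X = Z" "c * X + s * Y = 0" "s\<^sup>2 + c\<^sup>2 = 1"
      for X Y Z c s :: real
    proof -
      have "(s\<^sup>2 + c\<^sup>2) * X = c * (c * X + s * Y) - s * (c * Y - s * X)"
        by (simp add: algebra_simps power2_eq_square)
      then show ?thesis by (simp add: that(1) that(2) that(3))
    qed
    have "W q \<bullet> p = - (sin t * (W p \<bullet> u))"
      using a b sin_cos_squared_add[of t]
      unfolding inner_add_right inner_diff_right inner_scaleR_right by (rule solve)
    also have "\<dots> = - (W p \<bullet> q)"
      using arg_cong[OF q', of "\<lambda>x. W p \<bullet> x"] by (simp add: inner_add_right tan[OF p])
    finally show ?thesis by simp
  qed
qed

text \<open>
  The extension to the whole space is homogeneous of degree one, unlike the one of degree zero that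
  serves to differentiate \<open>W\<close>: it inherits the skew identity for all pairs of vectors. Then
  \<open>S x \<bullet> z = - (x \<bullet> S z)\<close> is linear in \<open>x\<close> for every \<open>z\<close>, and so is \<open>S\<close>.
\<close>
theorem killing_field_iff_skew:
  fixes W :: "'a::euclidean_space \<Rightarrow> 'a"
  assumes K: "K \<noteq> 0"
  shows "killing_field K W \<longleftrightarrow> (\<exists>S. skew S \<and> W = restrict S unit_sphere)"
proof
  assume W: "killing_field K W"
  define S where "S x = norm x *\<^sub>R W (sgn x)" for x
  have sk: "S x \<bullet> y = - (x \<bullet> S y)" for x y
  proof (cases "x = 0 \<or> y = 0")
    case False
    then have "W (sgn x) \<bullet> sgn y = - (W (sgn y) \<bullet> sgn x)"
      by (intro killing_field_inner[OF W K]) (auto simp: norm_sgn)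
    then have "norm x * norm y * (W (sgn x) \<bullet> sgn y) = - (norm x * norm y * (W (sgn y) \<bullet> sgn x))"
      by simp
    then show ?thesis using False
      by (simp add: S_def sgn_div_norm inner_commute field_simps)
  qed (auto simp: S_def)
  have "linear S"
  proof
    fix x y :: 'a and r :: real
    have "S (x + y) \<bullet> z = (S x + S y) \<bullet> z" "S (r *\<^sub>R x) \<bullet> z = (r *\<^sub>R S x) \<bullet> z" for z
      by (simp_all add: sk inner_add_left)
    then show "S (x + y) = S x + S y" "S (r *\<^sub>R x) = r *\<^sub>R S x"
      using vector_eq_rdot by blast+
  qed
  then have "skew S" using sk by (auto simp: skew_def)
  moreover have "W = restrict S unit_sphere"
    using W by (auto simp: S_def killing_field_def smooth_vector_field_def extensional_def
        sgn_div_norm fun_eq_iff)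
  ultimately show "\<exists>S. skew S \<and> W = restrict S unit_sphere" by blast
qed (auto intro: killing_field_skew)

section \<open>Orthogonal normal form of a skew map\<close>

text \<open>
  At a unit vector \<open>x\<close> of \<open>V\<close> that is stretched the most, with factor \<open>\<lambda>\<close>, the quadratic form
  \<open>\<lambda>\<^sup>2 (z \<bullet> z) - S z \<bullet> S z\<close> is nonnegative on \<open>V\<close> and zero at \<open>x\<close>. A
  nonnegative form vanishes only on its kernel, which makes \<open>x\<close> an eigenvector of \<open>S \<circ> S\<close>.
\<close>
lemma skew_stretch_maximiser:
  assumes S: "skew S" and V: "subspace V" "S ` V \<subseteq> V" "\<exists>z\<in>V. z \<noteq> 0"
  obtains x where "x \<in> V" "norm x = 1" "S (S x) = - ((norm (S x))\<^sup>2 *\<^sub>R x)"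
    "\<And>z. z \<in> V \<Longrightarrow> norm (S z) \<le> norm (S x) * norm z"
proof -
  have lin: "linear S" by (rule skewD(1)[OF S])
  let ?C = "sphere 0 1 \<inter> V"
  obtain z0 where z0: "z0 \<in> V" "z0 \<noteq> 0" using V(3) by blast
  have "sgn z0 \<in> ?C" using z0 V(1) by (simp add: norm_sgn) (simp add: sgn_div_norm subspace_scale)
  then have "?C \<noteq> {}" by blast
  moreover have "compact ?C" by (simp add: V(1) closed_subspace compact_Int_closed)
  moreover have "continuous_on ?C (\<lambda>x. norm (S x))"
    by (intro continuous_on_norm linear_continuous_on) (simp add: lin flip: linear_conv_bounded_linear)
  ultimately obtain x where x: "x \<in> ?C" and max: "\<And>z. z \<in> ?C \<Longrightarrow> norm (S z) \<le> norm (S x)"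
    using continuous_attains_sup by metis
  have xV: "x \<in> V" and nx: "norm x = 1" using x by auto
  have bound: "norm (S z) \<le> norm (S x) * norm z" if "z \<in> V" for z
  proof (cases "z = 0")
    case False
    then have "sgn z \<in> ?C" using that V(1) by (simp add: norm_sgn) (simp add: sgn_div_norm subspace_scale)
    from max[OF this] False show ?thesis
      by (simp add: sgn_div_norm linear_scale[OF lin] field_simps)
  qed (simp add: linear_0[OF lin])
  define l where "l = (norm (S x))\<^sup>2"
  define w where "w = l *\<^sub>R x + S (S x)"
  have wV: "w \<in> V" using V xV by (auto simp: w_def intro!: subspace_add subspace_scale)
  define c where "c = l * (w \<bullet> w) - S w \<bullet> S w"
  have c: "0 \<le> c" using power_mono[OF bound[OF wV], of 2]
    by (simp add: c_def l_def power_mult_distrib power2_norm_eq_inner)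
  \<comment> \<open>The form evaluated on the line \<open>x + t w\<close>: as \<open>x\<close> is a zero of it, no constant term remains.\<close>
  have quad: "0 \<le> 2 * t * (w \<bullet> w) + t\<^sup>2 * c" for t
  proof -
    have "x + t *\<^sub>R w \<in> V" using V xV wV by (auto intro!: subspace_add subspace_scale)
    from power_mono[OF bound[OF this], of 2]
    have "S (x + t *\<^sub>R w) \<bullet> S (x + t *\<^sub>R w) \<le> l * ((x + t *\<^sub>R w) \<bullet> (x + t *\<^sub>R w))"
      by (simp add: l_def power_mult_distrib power2_norm_eq_inner)
    moreover have "S (x + t *\<^sub>R w) \<bullet> S (x + t *\<^sub>R w)
        = l + 2 * t * (S x \<bullet> S w) + t\<^sup>2 * (S w \<bullet> S w)"
      by (simp add: linear_add[OF lin] linear_scale[OF lin] inner_add_left inner_add_right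
          inner_commute[of "S w" "S x"] power2_eq_square algebra_simps l_def power2_norm_eq_inner[unfolded power2_eq_square])
    moreover have "(x + t *\<^sub>R w) \<bullet> (x + t *\<^sub>R w) = 1 + 2 * t * (x \<bullet> w) + t\<^sup>2 * (w \<bullet> w)"
      using nx by (simp add: inner_add_left inner_add_right inner_commute[of w x] power2_eq_square algebra_simps
          norm_eq_1)
    ultimately have "l + 2 * t * (S x \<bullet> S w) + t\<^sup>2 * (S w \<bullet> S w)
        \<le> l * (1 + 2 * t * (x \<bullet> w) + t\<^sup>2 * (w \<bullet> w))"
      by (simp only:)
    then have "0 \<le> 2 * t * (l * (x \<bullet> w) - S x \<bullet> S w) + t\<^sup>2 * c"
      by (simp add: c_def algebra_simps)
    moreover have "w \<bullet> w = l * (x \<bullet> w) - S x \<bullet> S w"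
    proof -
      have "w \<bullet> w = l * (x \<bullet> w) + S (S x) \<bullet> w"
        by (subst (1) w_def) (simp add: inner_add_left)
      then show ?thesis using skewD(2)[OF S, of "S x" w] by simp
    qed
    ultimately show ?thesis by (simp only:)
  qed
  have "w \<bullet> w = 0"
  proof (rule ccontr)
    assume "w \<bullet> w \<noteq> 0"
    then have d: "0 < w \<bullet> w" by simp
    \<comment> \<open>For small negative \<open>t\<close> the linear term would win.\<close>
    have "2 * (w \<bullet> w) \<le> r * c" if "0 < r" for r
    proof -
      have "r * (2 * (w \<bullet> w)) \<le> r * (r * c)"
        using quad[of "- r"] by (simp add: power2_eq_square ac_simps)
      then show ?thesis using that by (simp only: mult_le_cancel_left_pos)
    qed
    from this[of "(w \<bullet> w) / (c + 1)"] have "2 * (w \<bullet> w) \<le> (w \<bullet> w) * (c / (c + 1))"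
      using d c by simp
    also have "\<dots> \<le> (w \<bullet> w) * 1"
      using d c by (intro mult_left_mono) auto
    finally show False using d by simp
  qed
  then have "S (S x) = - ((norm (S x))\<^sup>2 *\<^sub>R x)"
    by (simp add: w_def l_def add_eq_0_iff)
  with that xV nx bound show thesis by blast
qed

text \<open>
  The second basis vector of the plane is the direction of \<open>S x\<close>. When \<open>S\<close> vanishes on
  \<open>V\<close> there is no such direction, and any unit vector of \<open>V\<close> orthogonal to \<open>x\<close> serves; the
  third assumption on \<open>V\<close>, which amounts to \<open>V\<close> having dimension at least two, provides it.
\<close>
lemma skew_leading_plane:
  assumes S: "skew S" and V: "subspace V" "S ` V \<subseteq> V" "\<And>x. \<exists>z\<in>V. z \<noteq> 0 \<and> z \<bullet> x = 0"
  obtains x y l where "x \<in> V" "y \<in> V" "norm x = 1" "norm y = 1" "x \<bullet> y = 0" "0 \<le> l"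
    "S x = l *\<^sub>R y" "S y = - l *\<^sub>R x" "\<And>z. z \<in> V \<Longrightarrow> norm (S z) \<le> l * norm z"
proof -
  have lin: "linear S" by (rule skewD(1)[OF S])
  obtain x where x: "x \<in> V" "norm x = 1" "S (S x) = - ((norm (S x))\<^sup>2 *\<^sub>R x)"
    and bd: "\<And>z. z \<in> V \<Longrightarrow> norm (S z) \<le> norm (S x) * norm z"
    using skew_stretch_maximiser[OF S V(1,2)] V(3) by blast
  define l where "l = norm (S x)"
  obtain y where y: "y \<in> V" "norm y = 1" "x \<bullet> y = 0" "S x = l *\<^sub>R y"
  proof (cases "l = 0")
    case True
    obtain z where z: "z \<in> V" "z \<noteq> 0" "z \<bullet> x = 0" using V(3) by blast
    show thesis
      by (rule that[of "sgn z"])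
        (use z True V(1) in \<open>simp_all add: norm_sgn l_def\<close>,
         simp_all add: sgn_div_norm subspace_scale inner_commute)
  next
    case False
    have "S x \<in> V" using x(1) V(2) by blast
    then show thesis
      by (intro that[of "S x /\<^sub>R l"])
        (use False V(1) in \<open>auto simp: subspace_scale l_def skew_inner_self[OF S] inner_commute[of x]\<close>)
  qed
  have "S y = - l *\<^sub>R x"
  proof (cases "l = 0")
    case True
    then show ?thesis using bd[OF y(1)] by (simp add: l_def)
  next
    case False
    have "l *\<^sub>R S y = l *\<^sub>R (- l *\<^sub>R x)"
      using x(3) unfolding l_def[symmetric] unfolding y(4) by (simp add: linear_scale[OF lin] power2_eq_square)
    then show ?thesis using False by (simp only: scaleR_cancel_left) simp
  qed
  then show thesis
    using that[OF x(1) y(1) x(2) y(2) y(3) _ y(4)] bd by (simp only: l_def norm_ge_zero)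
qed

lemma exists_orthogonal_to_few:
  fixes e :: "'i \<Rightarrow> 'a::euclidean_space"
  assumes "finite I" "card I < DIM('a)"
  obtains z where "z \<noteq> 0" "\<And>i. i \<in> I \<Longrightarrow> z \<bullet> e i = 0"
proof -
  have "dim (e ` I) < DIM('a)"
    by (rule le_less_trans[OF dim_le_card' le_less_trans[OF card_image_le]]) (use assms in auto)
  then obtain z where z: "z \<noteq> 0" "\<And>y. y \<in> span (e ` I) \<Longrightarrow> orthogonal z y"
    using orthogonal_to_subspace_exists by blast
  show thesis
    by (rule that[OF z(1)]) (use z(2) in \<open>auto simp: orthogonal_def intro: span_base\<close>)
qed

text \<open>
  The last clause says that \<open>a k\<close> bounds the stretching on the orthogonal complement of the
  planes before the \<open>k\<close>-th. It carries the order of the \<open>a k\<close>, as every later plane lies in that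
  complement.
\<close>
definition normal_frame ::
    "('a::euclidean_space \<Rightarrow> 'a) \<Rightarrow> nat \<Rightarrow> (nat \<Rightarrow> 'a) \<Rightarrow> (nat \<Rightarrow> real) \<Rightarrow> bool" where
  "normal_frame S m e a \<longleftrightarrow>
     (\<forall>i\<in>{1..2*m}. \<forall>j\<in>{1..2*m}. e i \<bullet> e j = (if i = j then 1 else 0)) \<and>
     (\<forall>k\<in>{1..m}. 0 \<le> a k \<and> S (e (2*k - 1)) = a k *\<^sub>R e (2*k) \<and> S (e (2*k)) = - a k *\<^sub>R e (2*k - 1) \<and>
        (\<forall>z. (\<forall>i\<in>{1..2*(k-1)}. z \<bullet> e i = 0) \<longrightarrow> norm (S z) \<le> a k * norm z))"

lemma normal_frame_orthonormal:
  "normal_frame S m e a \<Longrightarrow> i \<in> {1..2*m} \<Longrightarrow> j \<in> {1..2*m} \<Longrightarrow> e i \<bullet> e j = (if i = j then 1 else 0)"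
  by (auto simp: normal_frame_def)

lemma normal_frame_block:
  assumes "normal_frame S m e a" "k \<in> {1..m}"
  shows "0 \<le> a k" "S (e (2*k - 1)) = a k *\<^sub>R e (2*k)" "S (e (2*k)) = - a k *\<^sub>R e (2*k - 1)"
    "(\<And>i. i \<in> {1..2*(k-1)} \<Longrightarrow> z \<bullet> e i = 0) \<Longrightarrow> norm (S z) \<le> a k * norm z"
  using assms by (auto simp: normal_frame_def)

lemma pair_index_cases:
  assumes "i \<in> {1..2*m}"
  obtains k where "k \<in> {1..m}" "i = 2*k - 1" | k where "k \<in> {1..m}" "i = 2*(k::nat)"
proof (cases "even i")
  case True
  then obtain k where "i = 2*k" by blast
  with assms that(2)[of k] show thesis by auto
next
  case False
  then obtain k where "i = 2*k + 1" by (elim oddE)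
  with assms that(1)[of "k+1"] show thesis by auto
qed

text \<open>
  The planes are invariant and \<open>S\<close> is skew, so their orthogonal complement is invariant too. This
  lets the construction of the frame go on inside the complement.
\<close>
lemma normal_frame_complement_invariant:
  assumes S: "skew S" and F: "normal_frame S m e a"
    and z: "\<And>i. i \<in> {1..2*m} \<Longrightarrow> z \<bullet> e i = 0" and i: "i \<in> {1..2*m}"
  shows "S z \<bullet> e i = 0"
proof -
  have "z \<bullet> S (e i) = 0"
    using i
  proof (cases rule: pair_index_cases)
    case (1 k)
    then show ?thesis using normal_frame_block(2)[OF F, of k] z[of "2*k"] by simp
  next
    case (2 k)
    then have "2*k - 1 \<in> {1..2*m}" by auto
    with 2 show ?thesis using normal_frame_block(3)[OF F, of k] z[of "2*k-1"] by simp
  qed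
  then show ?thesis using skewD(2)[OF S, of z "e i"] by simp
qed

lemma normal_frame_exists:
  fixes S :: "'a::euclidean_space \<Rightarrow> 'a"
  assumes S: "skew S" and "2*m \<le> DIM('a)"
  shows "\<exists>e a. normal_frame S m e a"
  using assms(2)
proof (induction m)
  case 0
  show ?case by (simp add: normal_frame_def)
next
  case (Suc m)
  then obtain e a where F: "normal_frame S m e a" by auto
  define V where "V = {z. \<forall>i\<in>{1..2*m}. z \<bullet> e i = 0}"
  have V: "subspace V" "S ` V \<subseteq> V"
    using normal_frame_complement_invariant[OF S F]
    by (auto simp: V_def subspace_def inner_add_left)
  \<comment> \<open>The \<open>2 m\<close> frame vectors and \<open>x\<close> are fewer than the dimension, so they leave an orthogonal direction.\<close>
  have ex: "\<exists>z\<in>V. z \<noteq> 0 \<and> z \<bullet> x = 0" for x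
  proof -
    obtain z where z: "z \<noteq> 0" "\<And>i. i \<in> {1..2*m+1} \<Longrightarrow> z \<bullet> (e(2*m+1 := x)) i = 0"
      using exists_orthogonal_to_few[of "{1..2*m+1}" "e(2*m+1 := x)"] Suc.prems by auto
    have "z \<bullet> e i = 0" if "i \<in> {1..2*m}" for i using z(2)[of i] that by auto
    moreover have "z \<bullet> x = 0" using z(2)[of "2*m+1"] by simp
    ultimately show ?thesis using z(1) unfolding V_def by blast
  qed
  obtain x y l where xy: "x \<in> V" "y \<in> V" "norm x = 1" "norm y = 1" "x \<bullet> y = 0" "0 \<le> l"
    "S x = l *\<^sub>R y" "S y = - l *\<^sub>R x" and bd: "\<And>z. z \<in> V \<Longrightarrow> norm (S z) \<le> l * norm z"
    using skew_leading_plane[OF S V ex] by blast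
  define e' where "e' = e(2*m+1 := x, 2*m+2 := y)"
  define a' where "a' = a(m+1 := l)"
  have old: "e' i = e i" if "i \<in> {1..2*m}" for i using that by (auto simp: e'_def)
  have new: "e' (2*m+1) = x" "e' (2*m+2) = y" by (auto simp: e'_def)
  have xx: "x \<bullet> x = 1" "y \<bullet> y = 1" "y \<bullet> x = 0" using xy by (auto simp: norm_eq_1 inner_commute)
  have perp: "x \<bullet> e i = 0" "y \<bullet> e i = 0" "e i \<bullet> x = 0" "e i \<bullet> y = 0" if "i \<in> {1..2*m}" for i
    using xy that by (auto simp: V_def inner_commute)
  have idx: "i \<in> {1..2*m} \<and> i \<noteq> 2*m+1 \<and> i \<noteq> 2*m+2 \<or> i = 2*m+1 \<or> i = 2*m+2" if "i \<in> {1..2*Suc m}" for i using that by auto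
  have on: "e' i \<bullet> e' j = (if i = j then 1 else 0)"
    if "i \<in> {1..2*Suc m}" "j \<in> {1..2*Suc m}" for i j
    using idx[OF that(1)] idx[OF that(2)]
    by (elim disjE conjE; simp only: old new xx xy(5) perp normal_frame_orthonormal[OF F]) auto
  have "0 \<le> a' k \<and> S (e' (2*k - 1)) = a' k *\<^sub>R e' (2*k) \<and> S (e' (2*k)) = - a' k *\<^sub>R e' (2*k - 1) \<and>
        (\<forall>z. (\<forall>i\<in>{1..2*(k-1)}. z \<bullet> e' i = 0) \<longrightarrow> norm (S z) \<le> a' k * norm z)"
    if k: "k \<in> {1..Suc m}" for k
  proof (cases "k = Suc m")
    case True
    then show ?thesis using xy bd by (auto simp: a'_def e'_def V_def)
  next
    case False
    then have k': "k \<in> {1..m}" using k by auto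
    then have i: "2*k - 1 \<in> {1..2*m}" "2*k \<in> {1..2*m}" "\<And>i. i \<in> {1..2*(k-1)} \<Longrightarrow> i \<in> {1..2*m}"
      by auto
    show ?thesis
      using normal_frame_block[OF F k'] False old[OF i(3)]
      by (simp only: old[OF i(1)] old[OF i(2)]) (simp add: a'_def)
  qed
  then have "normal_frame S (Suc m) e' a'"
    using on unfolding normal_frame_def by blast
  then show ?case by blast
qed

lemma normal_frame_decreasing:
  assumes F: "normal_frame S m e a" and "i \<in> {1..m}" "j \<in> {1..m}" "i \<le> j"
  shows "a j \<le> a i"
proof -
  have j: "2*j-1 \<in> {1..2*m}" "2*j \<in> {1..2*m}" using assms(3) by auto
  have n: "norm (e (2*j)) = 1" "norm (e (2*j-1)) = 1"
    using normal_frame_orthonormal[OF F j(2) j(2)] normal_frame_orthonormal[OF F j(1) j(1)]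
    by (simp_all add: norm_eq_1)
  have "norm (S (e (2*j))) \<le> a i * norm (e (2*j))"
  proof (rule normal_frame_block(4)[OF F assms(2)])
    fix l assume "l \<in> {1..2*(i-1)}"
    then show "e (2*j) \<bullet> e l = 0"
      using normal_frame_orthonormal[OF F j(2), of l] assms by auto
  qed
  then show ?thesis
    using normal_frame_block(1,3)[OF F assms(3)] n by simp
qed

section \<open>Block matrices and their frequencies\<close>

text \<open>
  The fibre cardinalities describe the multiset of values, and a sorted list is determined by its
  multiset. The lists are reversed because \<open>sorted\<close> means ascending.
\<close>
lemma antimono_eq_of_card_fibres:
  fixes f g :: "nat \<Rightarrow> 'b::linorder"
  assumes f: "\<And>i j. 1 \<le> i \<Longrightarrow> i \<le> j \<Longrightarrow> j \<le> N \<Longrightarrow> f j \<le> f i"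
    and g: "\<And>i j. 1 \<le> i \<Longrightarrow> i \<le> j \<Longrightarrow> j \<le> N \<Longrightarrow> g j \<le> g i"
    and card: "\<And>t. card {i\<in>{1..N}. f i = t} = card {i\<in>{1..N}. g i = t}"
    and i: "i \<in> {1..N}"
  shows "f i = g i"
proof -
  have sorted: "sorted (rev (map h [1..<N+1]))"
    if "\<And>i j. 1 \<le> i \<Longrightarrow> i \<le> j \<Longrightarrow> j \<le> N \<Longrightarrow> h j \<le> h i" for h :: "nat \<Rightarrow> 'b"
    using that by (subst sorted_wrt_rev) (auto simp: sorted_wrt_iff_nth_less simp del: upt_Suc)
  have count: "count (mset (map h [1..<N+1])) t = card {i\<in>{1..N}. h i = t}" for h :: "nat \<Rightarrow> 'b" and t
  proof -
    have "count (mset (map h xs)) t = length (filter (\<lambda>i. h i = t) xs)" for xs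
      by (induction xs) auto
    then have "count (mset (map h [1..<N+1])) t = length (filter (\<lambda>i. h i = t) [1..<N+1])" .
    also have "\<dots> = card {i\<in>{1..N}. h i = t}"
      by (subst distinct_card[symmetric]) (auto intro!: arg_cong[where f = card] simp del: upt_Suc)
    finally show ?thesis .
  qed
  have "mset (map f [1..<N+1]) = mset (map g [1..<N+1])"
    by (rule multiset_eqI) (simp only: count card)
  then have "mset (rev (map f [1..<N+1])) = mset (rev (map g [1..<N+1]))" by (simp only: mset_rev)
  moreover have "sorted (rev (map f [1..<N+1]))" by (rule sorted) (rule f)
  moreover have sg: "sorted (rev (map g [1..<N+1]))" by (rule sorted) (rule g)
  ultimately have "sort (rev (map g [1..<N+1])) = rev (map f [1..<N+1])"
    by (intro properties_for_sort)
  then have "rev (map f [1..<N+1]) = rev (map g [1..<N+1])"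
    by (simp only: sorted_sort_id[OF sg])
  then show ?thesis using i by (auto simp: map_eq_conv simp del: upt_Suc)
qed

lemma half_dim_eq: "half_dim n = (n + 1) div 2"
  by (auto simp: half_dim_def)

text \<open>
  The entry of the block that contains position \<open>i\<close>, each entry being attained at the two
  positions of its block. The position \<open>n + 1\<close> that is left without a block for even \<open>n\<close>
  gets \<open>0\<close>; as the entries are nonnegative, the sequence still decreases there, and the
  two parities can be treated alike.
\<close>
definition frequency :: "nat \<Rightarrow> (nat \<Rightarrow> real) \<Rightarrow> nat \<Rightarrow> real" where
  "frequency n a i = (if (i + 1) div 2 \<le> half_dim n then a ((i + 1) div 2) else 0)"

lemma frequency_nonneg:
  "a \<in> decreasing_nonneg_tuples (half_dim n) \<Longrightarrow> 1 \<le> i \<Longrightarrow> 0 \<le> frequency n a i"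
  by (auto simp: frequency_def decreasing_nonneg_tuples_def)

lemma frequency_antimono:
  assumes a: "a \<in> decreasing_nonneg_tuples (half_dim n)" and ij: "1 \<le> i" "i \<le> j"
  shows "frequency n a j \<le> frequency n a i"
proof (cases "(j + 1) div 2 \<le> half_dim n")
  case True
  moreover have "(i + 1) div 2 \<le> (j + 1) div 2" using ij by (intro div_le_mono) simp
  moreover have "1 \<le> (i + 1) div 2" using ij by simp
  ultimately show ?thesis
    using a by (auto simp: frequency_def decreasing_nonneg_tuples_def)
next
  case False
  then have "frequency n a j = 0" by (simp add: frequency_def)
  then show ?thesis using frequency_nonneg[OF a ij(1)] by simp
qed

lemma frequency_determines_tuple:
  assumes "a \<in> decreasing_nonneg_tuples (half_dim n)" "b \<in> decreasing_nonneg_tuples (half_dim n)"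
    and eq: "\<And>i. i \<in> {1..n+1} \<Longrightarrow> frequency n a i = frequency n b i"
  shows "a = b"
proof (rule PiE_ext[of _ "{1..half_dim n}" "\<lambda>_. UNIV"])
  fix k assume "k \<in> {1..half_dim n}"
  then have "2 * k \<in> {1..n+1}" "(2 * k + 1) div 2 = k" "k \<le> half_dim n" by (auto simp: half_dim_eq)
  with eq[of "2 * k"] show "a k = b k" by (simp add: frequency_def)
qed (use assms in \<open>auto simp: decreasing_nonneg_tuples_def\<close>)

lemma frequency_last: "frequency n a (n + 1) = (if even n then 0 else a (half_dim n))"
  by (auto simp: frequency_def half_dim_eq elim: evenE oddE)

locale enumerated_axes =
  fixes idx :: "'d::finite \<Rightarrow> nat" and n :: nat
  assumes idx_bij: "bij_betw idx UNIV {1..n + 1}"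
begin

definition block_map :: "(nat \<Rightarrow> real) \<Rightarrow> real^'d \<Rightarrow> real^'d" where
  "block_map a p = p v* block_matrix idx n a"

definition basis_vector :: "nat \<Rightarrow> real^'d" where
  "basis_vector i = axis (inv idx i) 1"

lemma normal_form_field_eq: "normal_form_field idx n a = restrict (block_map a) unit_sphere"
  by (simp add: normal_form_field_def block_map_def[abs_def])

lemma idx_range: "idx r \<in> {1..n + 1}"
  using idx_bij bij_betwE by blast

lemma idx_inj: "inj idx"
  using idx_bij bij_betw_def by blast

lemma idx_eq_iff: "i \<in> {1..n + 1} \<Longrightarrow> idx r = i \<longleftrightarrow> r = inv idx i"
  using idx_bij idx_inj by (metis bij_betw_imp_surj_on f_inv_into_f inv_f_f)

lemma axis_eq_basis_vector: "axis r 1 = basis_vector (idx r)"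
  by (simp add: basis_vector_def idx_inj)

lemma basis_vector_nth: "i \<in> {1..n + 1} \<Longrightarrow> basis_vector i $ r = (if idx r = i then 1 else 0)"
  by (auto simp: basis_vector_def axis_def idx_eq_iff)

lemma block_map_skew: "skew (block_map a)"
proof -
  let ?M = "block_matrix idx n a"
  have M: "?M $ r $ s = - (?M $ s $ r)" for r s
    unfolding block_matrix_def
    by (simp flip: sum_negf) (rule sum.cong, auto)
  have "linear (block_map a)"
    unfolding block_map_def[abs_def]
    by (rule linearI) (simp_all add: vector_matrix_left_distrib scaleR_vector_matrix_assoc)
  moreover have "block_map a p \<bullet> q = - (p \<bullet> block_map a q)" for p q
  proof -
    have "block_map a p \<bullet> q = (\<Sum>s\<in>UNIV. \<Sum>r\<in>UNIV. p $ r * ?M $ r $ s * q $ s)"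
      by (simp add: block_map_def inner_vec_def vector_matrix_mult_def sum_distrib_right)
    also have "\<dots> = (\<Sum>r\<in>UNIV. \<Sum>s\<in>UNIV. p $ r * ?M $ r $ s * q $ s)"
      by (rule sum.swap)
    also have "\<dots> = (\<Sum>r\<in>UNIV. \<Sum>s\<in>UNIV. - (p $ r * (?M $ s $ r * q $ s)))"
      by (intro sum.cong refl) (subst M, simp add: ac_simps)
    also have "\<dots> = - (p \<bullet> block_map a q)"
      by (simp add: block_map_def inner_vec_def vector_matrix_mult_def sum_distrib_left sum_negf ac_simps)
    finally show ?thesis .
  qed
  ultimately show ?thesis by (simp add: skew_def)
qed

lemmas block_map_linear = skewD(1)[OF block_map_skew]

lemma block_map_basis_vector:
  shows "k \<in> {1..half_dim n} \<Longrightarrow> block_map a (basis_vector (2*k - 1)) = a k *\<^sub>R basis_vector (2*k)"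
    and "k \<in> {1..half_dim n} \<Longrightarrow> block_map a (basis_vector (2*k)) = - a k *\<^sub>R basis_vector (2*k - 1)"
    and "even n \<Longrightarrow> block_map a (basis_vector (n + 1)) = 0"
proof -
  have row: "block_map a (basis_vector i) $ s = block_matrix idx n a $ inv idx i $ s" for i s
  proof -
    have "block_map a (basis_vector i) $ s =
        (\<Sum>r\<in>UNIV. if r = inv idx i then block_matrix idx n a $ r $ s else 0)"
      unfolding block_map_def basis_vector_def vector_matrix_mult_def axis_def vec_lambda_beta
      by (rule sum.cong) auto
    then show ?thesis by simp
  qed
  have inv: "idx (inv idx i) = i" if "i \<in> {1..n + 1}" for i
    using that idx_eq_iff by blast
  have parity: "2 * k - 1 = 2 * l - 1 \<longleftrightarrow> k = l" "2 * k \<noteq> 2 * l - 1" "2 * k - 1 \<noteq> 2 * l"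
    if "1 \<le> k" "1 \<le> l" for k l :: nat
    using that by presburger+
  show "block_map a (basis_vector (2*k - 1)) = a k *\<^sub>R basis_vector (2*k)"
    if k: "k \<in> {1..half_dim n}"
  proof -
    have r: "2*k - 1 \<in> {1..n+1}" "2*k \<in> {1..n+1}" using k by (auto simp: half_dim_eq)
    have "block_map a (basis_vector (2*k - 1)) $ s = (a k *\<^sub>R basis_vector (2*k)) $ s" for s
    proof -
      have "block_map a (basis_vector (2*k - 1)) $ s
          = (\<Sum>l = 1..half_dim n. if l = k then (if idx s = 2 * k then a k else 0) else 0)"
        unfolding row block_matrix_def vec_lambda_beta inv[OF r(1)]
        by (rule sum.cong) (use k parity[of k] in auto)
      then show ?thesis using k by (simp add: basis_vector_nth[OF r(2)])
    qed
    then show ?thesis by (simp add: vec_eq_iff)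
  qed
  show "block_map a (basis_vector (2*k)) = - a k *\<^sub>R basis_vector (2*k - 1)"
    if k: "k \<in> {1..half_dim n}"
  proof -
    have r: "2*k - 1 \<in> {1..n+1}" "2*k \<in> {1..n+1}" using k by (auto simp: half_dim_eq)
    have "block_map a (basis_vector (2*k)) $ s = (- a k *\<^sub>R basis_vector (2*k - 1)) $ s" for s
    proof -
      have "block_map a (basis_vector (2*k)) $ s
          = (\<Sum>l = 1..half_dim n. if l = k then (if idx s = 2 * k - 1 then - a k else 0) else 0)"
        unfolding row block_matrix_def vec_lambda_beta inv[OF r(2)]
        by (rule sum.cong) (use k parity[of k] in auto)
      then show ?thesis using k by (simp add: basis_vector_nth[OF r(1)] del: One_nat_def)
    qed
    then show ?thesis by (simp add: vec_eq_iff)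
  qed
  show "block_map a (basis_vector (n + 1)) = 0" if "even n"
  proof -
    have i: "n + 1 \<in> {1..n+1}" by simp
    have out: "n + 1 \<noteq> 2 * l - 1" "n + 1 \<noteq> 2 * l" if "l \<in> {1..half_dim n}" for l
      using \<open>even n\<close> that by (auto simp: half_dim_eq)
    have "block_map a (basis_vector (n + 1)) $ s = 0" for s
      unfolding row block_matrix_def vec_lambda_beta inv[OF i]
      by (rule sum.neutral) (use out in auto)
    then show ?thesis by (simp add: vec_eq_iff)
  qed
qed

lemma index_cases:
  assumes "i \<in> {1..n + 1}"
  obtains k where "k \<in> {1..half_dim n}" "i = 2*k - 1" | k where "k \<in> {1..half_dim n}" "i = 2*k"
  | "even n" "i = n + 1"
proof (cases "i \<le> 2 * half_dim n")
  case True
  with assms have "i \<in> {1..2 * half_dim n}" by simp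
  then show thesis by (cases rule: pair_index_cases) (use that in blast)+
next
  case False
  then show thesis using assms that(3) by (cases "even n") (auto simp: half_dim_eq elim!: evenE oddE)
qed

text \<open>
  A block \<open>a J\<close> squares to \<open>- a\<^sup>2\<close> times the identity.
\<close>
lemma block_map_twice:
  "block_map a (block_map a p) = (\<chi> r. - ((frequency n a (idx r))\<^sup>2 * p $ r))"
proof -
  have "(\<lambda>p. block_map a (block_map a p)) = (\<lambda>p. \<chi> r. - ((frequency n a (idx r))\<^sup>2 * p $ r))"
  proof (rule linear_eq_stdbasis)
    show "linear (\<lambda>p. block_map a (block_map a p))"
      using linear_compose[OF block_map_linear block_map_linear] by (simp add: o_def)
    show "linear (\<lambda>p. (\<chi> r. - ((frequency n a (idx r))\<^sup>2 * p $ r)) :: real^'d)"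
      by (rule linearI) (simp_all add: vec_eq_iff algebra_simps)
    fix b :: "real^'d" assume "b \<in> Basis"
    then obtain r where r: "b = basis_vector (idx r)"
      by (auto simp: Basis_vec_def axis_eq_basis_vector)
    have rhs: "(\<chi> s. - ((frequency n a (idx s))\<^sup>2 * b $ s)) = - ((frequency n a (idx r))\<^sup>2) *\<^sub>R b"
      using basis_vector_nth[OF idx_range, of r] by (auto simp: vec_eq_iff r)
    show "block_map a (block_map a b) = (\<chi> s. - ((frequency n a (idx s))\<^sup>2 * b $ s))"
      unfolding rhs unfolding r using idx_range[of r]
    proof (cases rule: index_cases)
      case (1 k)
      then have "(2 * k - 1 + 1) div 2 = k" by auto
      then have "frequency n a (2 * k - 1) = a k" using 1 by (simp only: frequency_def) simp
      with 1 show "block_map a (block_map a (basis_vector (idx r)))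
          = - ((frequency n a (idx r))\<^sup>2) *\<^sub>R basis_vector (idx r)"
        using block_map_basis_vector(1,2)[of k a]
        by (simp add: linear_scale[OF block_map_linear] power2_eq_square)
    next
      case (2 k)
      then have "frequency n a (2 * k) = a k" by (simp add: frequency_def)
      with 2 show "block_map a (block_map a (basis_vector (idx r)))
          = - ((frequency n a (idx r))\<^sup>2) *\<^sub>R basis_vector (idx r)"
        using block_map_basis_vector(1,2)[of k a]
        by (simp add: linear_scale[OF block_map_linear] linear_neg[OF block_map_linear] power2_eq_square)
    next
      case 3
      then show "block_map a (block_map a (basis_vector (idx r)))
          = - ((frequency n a (idx r))\<^sup>2) *\<^sub>R basis_vector (idx r)"
        using block_map_basis_vector(3)[of a] frequency_last[of n a]
        by (simp add: linear_0[OF block_map_linear])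
    qed
  qed
  then show ?thesis by (rule fun_cong)
qed

text \<open>
  Skewness turns the squared norm into \<open>- (p \<bullet> block_map a (block_map a p))\<close>, where the square of
  the block map is diagonal.
\<close>
lemma norm_block_map:
  "(norm (block_map a p))\<^sup>2 = (\<Sum>r\<in>UNIV. (frequency n a (idx r))\<^sup>2 * (p $ r)\<^sup>2)"
proof -
  have "(norm (block_map a p))\<^sup>2 = - (p \<bullet> block_map a (block_map a p))"
    by (simp add: power2_norm_eq_inner skewD(2)[OF block_map_skew, of a p])
  then show ?thesis
    by (simp add: block_map_twice inner_vec_def sum_negf power2_eq_square ac_simps)
qed

text \<open>
  A diagonal matrix has an eigenspace spanned by the axes that carry the eigenvalue. Nonnegativity
  of \<open>t\<close> and of the frequencies makes them recoverable from their squares.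
\<close>
lemma dim_eigenspace:
  assumes "0 \<le> t" and a: "a \<in> decreasing_nonneg_tuples (half_dim n)"
  shows "dim {p. block_map a (block_map a p) = - (t\<^sup>2) *\<^sub>R p} = card {i\<in>{1..n+1}. frequency n a i = t}"
proof -
  let ?D = "{r. frequency n a (idx r) = t}"
  have "(frequency n a (idx r))\<^sup>2 = t\<^sup>2 \<longleftrightarrow> frequency n a (idx r) = t" for r
    using frequency_nonneg[OF a] idx_range[of r] assms(1) by (auto intro: power2_eq_imp_eq)
  then have "{p. block_map a (block_map a p) = - (t\<^sup>2) *\<^sub>R p} = {p. \<forall>r. r \<notin> ?D \<longrightarrow> p $ r = 0}"
    by (auto simp: block_map_twice vec_eq_iff)
  then have "dim {p. block_map a (block_map a p) = - (t\<^sup>2) *\<^sub>R p} = card ?D"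
    by (simp only: dim_substandard_cart flip: dim_vec_eq)
  also have "\<dots> = card (idx ` ?D)"
    using idx_inj by (simp add: card_image inj_on_subset)
  also have "idx ` ?D = {i\<in>{1..n+1}. frequency n a i = t}"
    using idx_bij by (auto simp: bij_betw_def)
  finally show ?thesis .
qed

text \<open>
  The isomorphism \<open>\<phi>\<close> carries eigenspaces of the square of one block map onto those of the other,
  so both tuples have equally many frequencies of each value; and they are sorted.
\<close>
lemma block_map_similar_imp_eq:
  assumes a: "a \<in> decreasing_nonneg_tuples (half_dim n)" and b: "b \<in> decreasing_nonneg_tuples (half_dim n)"
    and \<phi>: "linear \<phi>" "bij \<phi>" and conj: "\<And>x. \<phi> (block_map a x) = block_map b (\<phi> x)"
  shows "a = b"
proof (rule frequency_determines_tuple[OF a b])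
  have "card {i\<in>{1..n+1}. frequency n a i = t} = card {i\<in>{1..n+1}. frequency n b i = t}" for t
  proof (cases "0 \<le> t")
    case True
    let ?E = "\<lambda>c. {p. block_map c (block_map c p) = - (t\<^sup>2) *\<^sub>R p}"
    have iff: "\<phi> p \<in> ?E b \<longleftrightarrow> p \<in> ?E a" for p
    proof -
      have "block_map b (block_map b (\<phi> p)) = \<phi> (block_map a (block_map a p))" by (simp add: conj)
      moreover have "- (t\<^sup>2) *\<^sub>R \<phi> p = \<phi> (- (t\<^sup>2) *\<^sub>R p)" by (simp only: linear_scale[OF \<phi>(1)])
      ultimately show ?thesis
        using bij_is_inj[OF \<phi>(2)] by (simp only: mem_Collect_eq inj_eq)
    qed
    have "\<phi> ` ?E a = ?E b"
    proof
      show "?E b \<subseteq> \<phi> ` ?E a"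
      proof
        fix q assume "q \<in> ?E b"
        moreover obtain p where "q = \<phi> p" using bij_is_surj[OF \<phi>(2)] by blast
        ultimately show "q \<in> \<phi> ` ?E a" using iff by blast
      qed
    qed (use iff in blast)
    moreover have "dim (\<phi> ` ?E a) = dim (?E a)"
      by (rule dim_image_eq[OF \<phi>(1)]) (use bij_is_inj[OF \<phi>(2)] in \<open>auto intro: inj_on_subset\<close>)
    ultimately show ?thesis
      using dim_eigenspace[OF True a] dim_eigenspace[OF True b] by simp
  next
    case False
    then have "{i\<in>{1..n+1}. frequency n c i = t} = {}"
      if "c \<in> decreasing_nonneg_tuples (half_dim n)" for c
      using frequency_nonneg[OF that] by fastforce
    from this[OF a] this[OF b] show ?thesis by (simp only:)
  qed
  then show "frequency n a i = frequency n b i" if "i \<in> {1..n+1}" for i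
    using antimono_eq_of_card_fibres[of "n+1" "frequency n a" "frequency n b" i] that
      frequency_antimono[OF a] frequency_antimono[OF b] by blast
qed

end

section \<open>Isometry orbits and convexity\<close>

lemma linear_eq_on_sphere:
  fixes S T :: "'a::euclidean_space \<Rightarrow> 'a"
  assumes "linear S" "linear T" and eq: "restrict S unit_sphere = restrict T unit_sphere"
  shows "S = T"
proof (rule linear_eq_stdbasis[OF assms(1,2)])
  fix b :: 'a assume "b \<in> Basis"
  then have "b \<in> unit_sphere" by simp
  then show "S b = T b" using fun_cong[OF eq, of b] by simp
qed

lemma pushforward_linear:
  fixes S :: "'a::euclidean_space \<Rightarrow> 'a"
  assumes \<phi>: "orthogonal_transformation \<phi>"
  shows "pushforward \<phi> (restrict S unit_sphere) = restrict (\<phi> \<circ> S \<circ> inv \<phi>) unit_sphere"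
proof -
  have "frechet_derivative \<phi> (at x) = \<phi>" for x
    using frechet_derivative_at[OF linear_imp_has_derivative] \<phi>
    by (metis orthogonal_transformation_linear)
  moreover have "norm (inv \<phi> q) = norm q" for q
    using \<phi> orthogonal_transformation_inv orthogonal_transformation_norm by metis
  ultimately show ?thesis by (auto simp: pushforward_def fun_eq_iff)
qed

text \<open>
  Stating conjugacy as \<open>\<phi> \<circ> S = T \<circ> \<phi>\<close> keeps inverses out of the later arguments.
\<close>
lemma isometry_orbit_linear:
  fixes S :: "'a::euclidean_space \<Rightarrow> 'a"
  assumes S: "linear S"
  shows "isometry_orbit (restrict S unit_sphere) = {restrict T unit_sphere | T.
    linear T \<and> (\<exists>\<phi>. orthogonal_transformation \<phi> \<and> (\<forall>x. \<phi> (S x) = T (\<phi> x)))}"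
    (is "_ = ?R")
proof
  show "isometry_orbit (restrict S unit_sphere) \<subseteq> ?R"
  proof
    fix W assume "W \<in> isometry_orbit (restrict S unit_sphere)"
    then obtain \<phi> where \<phi>: "orthogonal_transformation \<phi>"
      and W: "W = restrict (\<phi> \<circ> S \<circ> inv \<phi>) unit_sphere"
      by (auto simp: isometry_orbit_def pushforward_linear)
    have "linear (\<phi> \<circ> S \<circ> inv \<phi>)"
      using \<phi> S by (intro linear_compose) (auto simp: orthogonal_transformation_linear orthogonal_transformation_inv)
    moreover have "\<phi> (S x) = (\<phi> \<circ> S \<circ> inv \<phi>) (\<phi> x)" for x
      using orthogonal_transformation_inj[OF \<phi>] by simp
    ultimately show "W \<in> ?R" using W \<phi> by blast
  qed
  show "?R \<subseteq> isometry_orbit (restrict S unit_sphere)"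
  proof
    fix W assume "W \<in> ?R"
    then obtain T \<phi> where W: "W = restrict T unit_sphere" and \<phi>: "orthogonal_transformation \<phi>"
      and conj: "\<And>x. \<phi> (S x) = T (\<phi> x)" by blast
    have "T = \<phi> \<circ> S \<circ> inv \<phi>"
      using orthogonal_transformation_surj[OF \<phi>] by (auto simp: conj surj_f_inv_f)
    with W have "W = pushforward \<phi> (restrict S unit_sphere)"
      by (simp only: pushforward_linear[OF \<phi>])
    then show "W \<in> isometry_orbit (restrict S unit_sphere)"
      using \<phi> by (auto simp: isometry_orbit_def)
  qed
qed

lemma orthogonal_conjugacy_sym:
  fixes \<phi> S T :: "'a::euclidean_space \<Rightarrow> 'a"
  assumes \<phi>: "orthogonal_transformation \<phi>" and conj: "\<And>x. \<phi> (S x) = T (\<phi> x)"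
  shows "inv \<phi> (T x) = S (inv \<phi> x)"
proof -
  have "\<phi> (inv \<phi> x) = x" using orthogonal_transformation_surj[OF \<phi>] by (simp add: surj_f_inv_f)
  then have "T x = \<phi> (S (inv \<phi> x))" by (simp add: conj)
  then show ?thesis using orthogonal_transformation_inj[OF \<phi>] by simp
qed

lemma isometry_orbit_eq_iff:
  fixes S T :: "'a::euclidean_space \<Rightarrow> 'a"
  assumes S: "linear S" and T: "linear T"
  shows "isometry_orbit (restrict S unit_sphere) = isometry_orbit (restrict T unit_sphere) \<longleftrightarrow>
    (\<exists>\<phi>. orthogonal_transformation \<phi> \<and> (\<forall>x. \<phi> (S x) = T (\<phi> x)))"
proof
  assume eq: "isometry_orbit (restrict S unit_sphere) = isometry_orbit (restrict T unit_sphere)"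
  have "restrict T unit_sphere \<in> isometry_orbit (restrict T unit_sphere)"
    unfolding isometry_orbit_linear[OF T]
    using T orthogonal_transformation_id by fastforce
  then obtain T' where T': "restrict T unit_sphere = restrict T' unit_sphere" "linear T'"
      "\<exists>\<phi>. orthogonal_transformation \<phi> \<and> (\<forall>x. \<phi> (S x) = T' (\<phi> x))"
    unfolding eq[symmetric] isometry_orbit_linear[OF S] by blast
  then have "T' = T" using linear_eq_on_sphere[OF T T'(2)] by simp
  with T'(3) show "\<exists>\<phi>. orthogonal_transformation \<phi> \<and> (\<forall>x. \<phi> (S x) = T (\<phi> x))" by simp
next
  have sub: "isometry_orbit (restrict T unit_sphere) \<subseteq> isometry_orbit (restrict S unit_sphere)"
    if S: "linear S" and T: "linear T" and \<phi>: "orthogonal_transformation \<phi>"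
      and conj: "\<And>x. \<phi> (S x) = T (\<phi> x)"
    for S T \<phi> :: "'a \<Rightarrow> 'a"
  proof -
    have "\<exists>\<xi>. orthogonal_transformation \<xi> \<and> (\<forall>x. \<xi> (S x) = U (\<xi> x))"
      if \<psi>: "orthogonal_transformation \<psi>" "\<And>x. \<psi> (T x) = U (\<psi> x)" for U \<psi>
      by (rule exI[of _ "\<psi> \<circ> \<phi>"]) (simp add: \<phi> \<psi> conj orthogonal_transformation_compose)
    then show ?thesis
      unfolding isometry_orbit_linear[OF S] isometry_orbit_linear[OF T] by blast
  qed
  assume "\<exists>\<phi>. orthogonal_transformation \<phi> \<and> (\<forall>x. \<phi> (S x) = T (\<phi> x))"
  then obtain \<phi> where \<phi>: "orthogonal_transformation \<phi>" "\<And>x. \<phi> (S x) = T (\<phi> x)" by blast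
  show "isometry_orbit (restrict S unit_sphere) = isometry_orbit (restrict T unit_sphere)"
  proof
    have "inv \<phi> (T x) = S (inv \<phi> x)" for x
      by (rule orthogonal_conjugacy_sym) (rule \<phi>)+
    then show "isometry_orbit (restrict S unit_sphere) \<subseteq> isometry_orbit (restrict T unit_sphere)"
      by (intro sub[OF T S orthogonal_transformation_inv[OF \<phi>(1)]])
  qed (rule sub[OF S T \<phi>])
qed

lemma strongly_convex_at_iff:
  assumes "0 < K" "p \<in> unit_sphere"
  shows "strongly_convex_at K (restrict S unit_sphere) p \<longleftrightarrow> norm (S p) < sqrt K"
proof -
  have "sqrt (sphere_metric K (S p) (S p)) = norm (S p) / sqrt K"
    by (simp add: sphere_metric_def real_sqrt_divide norm_eq_sqrt_inner)
  then show ?thesis using assms by (simp add: strongly_convex_at_def)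
qed

text \<open>
  A linear field is continuous, so strong convexity at a single point spreads to a neighbourhood of it.
\<close>
lemma moduli_space_eq:
  assumes K: "0 < K"
  shows "moduli_space K = {isometry_orbit (restrict S unit_sphere) | S::'a::euclidean_space \<Rightarrow> 'a.
    skew S \<and> (\<exists>p\<in>unit_sphere. norm (S p) < sqrt K)}"
proof -
  have "(\<exists>U. openin (top_of_set unit_sphere) U \<and> U \<noteq> {} \<and>
          (\<forall>p\<in>U. strongly_convex_at K (restrict S unit_sphere) p)) \<longleftrightarrow>
        (\<exists>p\<in>unit_sphere. norm (S p) < sqrt K)" (is "?L \<longleftrightarrow> ?R") if S: "skew S" for S :: "'a \<Rightarrow> 'a"
  proof
    assume ?L
    then obtain U p where U: "openin (top_of_set unit_sphere) U" "p \<in> U"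
      "strongly_convex_at K (restrict S unit_sphere) p" by blast
    then have "p \<in> unit_sphere" using openin_imp_subset by blast
    then show ?R using U(3) strongly_convex_at_iff[OF K] by blast
  next
    assume R: ?R
    let ?U = "{p\<in>unit_sphere. norm (S p) < sqrt K}"
    have "open {p. norm (S p) < sqrt K}"
      by (intro open_Collect_less continuous_on_norm linear_continuous_on continuous_on_const)
        (simp add: skewD(1)[OF S] flip: linear_conv_bounded_linear)
    then have "openin (top_of_set unit_sphere) ?U"
      by (metis Collect_conj_eq Collect_mem_eq openin_open_Int)
    moreover have "?U \<noteq> {}" using R by blast
    moreover have "\<forall>p\<in>?U. strongly_convex_at K (restrict S unit_sphere) p"
      using strongly_convex_at_iff[OF K] by blast
    ultimately show ?L by blast
  qed
  moreover have "killing_field K W \<longleftrightarrow> (\<exists>S. skew S \<and> W = restrict S unit_sphere)" for W :: "'a \<Rightarrow> 'a"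
    using K by (intro killing_field_iff_skew) simp
  ultimately show ?thesis
    unfolding moduli_space_def by (simp only:) blast
qed

lemma globally_convex_orbit_iff:
  fixes S :: "'a::euclidean_space \<Rightarrow> 'a"
  assumes K: "0 < K" and S: "linear S"
  shows "(\<forall>W\<in>isometry_orbit (restrict S unit_sphere). \<forall>p\<in>unit_sphere. strongly_convex_at K W p) \<longleftrightarrow>
    (\<forall>p\<in>unit_sphere. norm (S p) < sqrt K)" (is "?L \<longleftrightarrow> ?R")
proof
  assume L: ?L
  have "restrict S unit_sphere \<in> isometry_orbit (restrict S unit_sphere)"
    unfolding isometry_orbit_linear[OF S]
    using S orthogonal_transformation_id by fastforce
  then show ?R using L strongly_convex_at_iff[OF K] by blast
next
  assume R: ?R
  show ?L
  proof (intro ballI)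
    fix W and p :: 'a assume W: "W \<in> isometry_orbit (restrict S unit_sphere)" and p: "p \<in> unit_sphere"
    then obtain T \<phi> where W: "W = restrict T unit_sphere" and \<phi>: "orthogonal_transformation \<phi>"
      and conj: "\<And>x. \<phi> (S x) = T (\<phi> x)"
      unfolding isometry_orbit_linear[OF S] by blast
    obtain q where q: "p = \<phi> q" using orthogonal_transformation_surj[OF \<phi>] by blast
    have "norm (T p) = norm (S q)" "q \<in> unit_sphere"
      using p by (simp_all add: q orthogonal_transformation_norm[OF \<phi>] flip: conj)
    then show "strongly_convex_at K W p" using R p strongly_convex_at_iff[OF K] W by metis
  qed
qed

section \<open>The parametrization\<close>

context enumerated_axes
begin

lemma dim_eq: "DIM(real^'d) = n + 1"
  using bij_betw_same_card[OF idx_bij] by simp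

text \<open>
  The orthogonal map sends the \<open>i\<close>-th axis to the \<open>i\<close>-th vector of a normal frame. For even
  \<open>n\<close> the frame misses one dimension and a unit vector \<open>z\<close> orthogonal to it is added. The map
  \<open>S\<close> kills \<open>z\<close>: its value there is orthogonal to the frame because the complement of the
  frame is invariant, and to \<open>z\<close> because \<open>S\<close> is skew.
\<close>
lemma skew_similar_to_block_map:
  fixes S :: "real^'d \<Rightarrow> real^'d"
  assumes S: "skew S"
  obtains a \<phi> where "a \<in> decreasing_nonneg_tuples (half_dim n)" "orthogonal_transformation \<phi>"
    "\<And>p. \<phi> (block_map a p) = S (\<phi> p)"
proof -
  define m where "m = half_dim n"
  have m: "2 * m \<le> n + 1" by (simp add: m_def half_dim_eq)
  obtain e a0 where F0: "normal_frame S m e a0"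
    using normal_frame_exists[OF S, of m] m unfolding dim_eq by blast
  \<comment> \<open>Tuples are \<open>undefined\<close> off \<open>{1..m}\<close>, which a frame does not ensure.\<close>
  define a where "a = restrict a0 {1..m}"
  have F: "normal_frame S m e a" using F0 unfolding normal_frame_def a_def by simp
  have "a \<in> decreasing_nonneg_tuples m"
    using normal_frame_decreasing[OF F] normal_frame_block(1)[OF F]
    by (auto simp: decreasing_nonneg_tuples_def a_def)
  have "\<exists>z. 2 * m < n + 1 \<longrightarrow> z \<bullet> z = 1 \<and> (\<forall>i\<in>{1..2*m}. z \<bullet> e i = 0)"
  proof (cases "2 * m < n + 1")
    case True
    then obtain z where z: "z \<noteq> 0" "\<And>i. i \<in> {1..2*m} \<Longrightarrow> z \<bullet> e i = 0"
      using exists_orthogonal_to_few[of "{1..2*m}" e] unfolding dim_eq by auto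
    have "sgn z \<bullet> sgn z = 1" using z(1) by (simp add: norm_sgn flip: norm_eq_1)
    moreover have "sgn z \<bullet> e i = 0" if "i \<in> {1..2*m}" for i
      using z(2)[OF that] by (simp add: sgn_div_norm)
    ultimately show ?thesis by blast
  qed blast
  then obtain z where z: "2 * m < n + 1 \<Longrightarrow> z \<bullet> z = 1"
    "\<And>i. 2 * m < n + 1 \<Longrightarrow> i \<in> {1..2*m} \<Longrightarrow> z \<bullet> e i = 0" by blast
  define f where "f i = (if i \<le> 2 * m then e i else z)" for i
  have f: "f i \<bullet> f j = (if i = j then 1 else 0)" if "i \<in> {1..n+1}" "j \<in> {1..n+1}" for i j
  proof -
    have dich: "i \<in> {1..2*m} \<or> \<not> i \<le> 2 * m \<and> 2 * m < n + 1 \<and> i = n + 1"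
      if "i \<in> {1..n+1}" for i using that by (auto simp: m_def half_dim_eq)
    show ?thesis
      using dich[OF that(1)] dich[OF that(2)] normal_frame_orthonormal[OF F, of i j]
        z(1) z(2)[of i] z(2)[of j]
      by (auto simp: f_def inner_commute)
  qed
  define \<phi> :: "real^'d \<Rightarrow> real^'d" where "\<phi> p = (\<Sum>r\<in>UNIV. p $ r *\<^sub>R f (idx r))" for p
  have f_idx: "f (idx r) \<bullet> f (idx s) = (if r = s then 1 else 0)" for r s
    using f[OF idx_range idx_range, of r s] idx_inj by (simp add: inj_eq)
  have "linear \<phi>"
    by (rule linearI) (simp_all add: \<phi>_def scaleR_left_distrib sum.distrib scaleR_sum_right)
  moreover have inner_\<phi>_f: "\<phi> p \<bullet> f (idx s) = p $ s" for p s
    by (simp add: \<phi>_def inner_sum_left f_idx if_distrib cong: if_cong)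
  moreover have "\<phi> p \<bullet> \<phi> q = p \<bullet> q" for p q
    unfolding \<phi>_def[of q] inner_sum_right inner_scaleR_right inner_\<phi>_f by (simp add: inner_vec_def mult.commute)
  ultimately have \<phi>: "orthogonal_transformation \<phi>"
    by (simp add: orthogonal_transformation_def)
  have \<phi>_axis: "\<phi> (basis_vector i) = f i" if "i \<in> {1..n+1}" for i
  proof -
    have "\<phi> (basis_vector i) = (\<Sum>r\<in>UNIV. if r = inv idx i then f (idx r) else 0)"
      unfolding \<phi>_def by (rule sum.cong) (use that in \<open>auto simp: basis_vector_nth idx_eq_iff\<close>)
    moreover have "idx (inv idx i) = i" using idx_eq_iff[OF that] by blast
    ultimately show ?thesis by simp
  qed
  have "(\<lambda>p. \<phi> (block_map a p)) = (\<lambda>p. S (\<phi> p))"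
  proof (rule linear_eq_stdbasis)
    show "linear (\<lambda>p. \<phi> (block_map a p))" "linear (\<lambda>p. S (\<phi> p))"
      using linear_compose[OF block_map_linear \<open>linear \<phi>\<close>] linear_compose[OF \<open>linear \<phi>\<close> skewD(1)[OF S]]
      by (simp_all add: o_def)
    fix b :: "real^'d" assume "b \<in> Basis"
    then obtain r where r: "b = basis_vector (idx r)"
      by (auto simp: Basis_vec_def axis_eq_basis_vector)
    show "\<phi> (block_map a b) = S (\<phi> b)"
      unfolding r \<phi>_axis[OF idx_range] using idx_range[of r]
    proof (cases rule: index_cases)
      case (1 k)
      then have k: "2 * k - 1 \<le> 2 * m" "2 * k \<le> 2 * m" "2 * k \<in> {1..n+1}" "k \<in> {1..m}"
        using m by (auto simp: m_def)
      show "\<phi> (block_map a (basis_vector (idx r))) = S (f (idx r))"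
        unfolding 1(2) block_map_basis_vector(1)[OF 1(1)] linear_scale[OF \<open>linear \<phi>\<close>] \<phi>_axis[OF k(3)]
        using k normal_frame_block(2)[OF F k(4)] by (simp add: f_def)
    next
      case (2 k)
      then have k: "2 * k - 1 \<le> 2 * m" "2 * k \<le> 2 * m" "2 * k - 1 \<in> {1..n+1}" "k \<in> {1..m}"
        using m by (auto simp: m_def)
      show "\<phi> (block_map a (basis_vector (idx r))) = S (f (idx r))"
        unfolding 2(2) block_map_basis_vector(2)[OF 2(1)] linear_scale[OF \<open>linear \<phi>\<close>] \<phi>_axis[OF k(3)]
        using k normal_frame_block(3)[OF F k(4)] by (simp add: f_def)
    next
      case 3
      then have less: "2 * m < n + 1" by (auto simp: m_def half_dim_eq)
      then have fz: "f (n + 1) = z" by (simp add: f_def)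
      obtain p where p: "S z = \<phi> p" using orthogonal_transformation_surj[OF \<phi>] by blast
      have "S z \<bullet> f i = 0" if "i \<in> {1..n+1}" for i
      proof (cases "i \<le> 2 * m")
        case True
        then show ?thesis
          using normal_frame_complement_invariant[OF S F z(2)[OF less], of i] that by (simp add: f_def)
      next
        case False
        then show ?thesis by (simp add: f_def skew_inner_self[OF S])
      qed
      then have "p $ s = 0" for s
        using inner_\<phi>_f[of p s] idx_range[of s] by (simp add: p)
      then have "p = 0" by (simp add: vec_eq_iff)
      then have "S z = 0" by (simp add: p linear_0[OF \<open>linear \<phi>\<close>])
      then show "\<phi> (block_map a (basis_vector (idx r))) = S (f (idx r))"
        using 3 by (simp only: block_map_basis_vector(3) fz linear_0[OF \<open>linear \<phi>\<close>])
    qed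
  qed
  then show thesis
    using that[of a \<phi>] \<phi> \<open>a \<in> decreasing_nonneg_tuples m\<close> by (simp add: m_def fun_eq_iff)
qed

lemma sum_sq_unit: "p \<in> unit_sphere \<Longrightarrow> (\<Sum>r\<in>UNIV. (p $ r)\<^sup>2) = 1" for p :: "real^'d"
  by (simp add: norm_eq_1 inner_vec_def power2_eq_square)

text \<open>
  For a unit vector \<open>p\<close> the squares of its coordinates are the weights of a convex combination of
  the squared frequencies. The extreme frequencies are the first and the last one.
\<close>
lemma block_map_norm_bounds_iff:
  assumes a: "a \<in> decreasing_nonneg_tuples (half_dim n)"
  shows "(\<exists>p\<in>unit_sphere. norm (block_map a p) < c) \<longleftrightarrow> frequency n a (n + 1) < c"
    and "(\<forall>p\<in>unit_sphere. norm (block_map a p) < c) \<longleftrightarrow> frequency n a 1 < c"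
proof -
  have norm_basis: "norm (block_map a (basis_vector i)) = frequency n a i" "basis_vector i \<in> unit_sphere"
    if i: "i \<in> {1..n+1}" for i
  proof -
    obtain r where r: "idx r = i" using idx_eq_iff[OF i] by blast
    have b: "basis_vector i = axis r 1" using r axis_eq_basis_vector by simp
    have "(norm (block_map a (basis_vector i)))\<^sup>2 = (\<Sum>s\<in>UNIV. if s = r then (frequency n a i)\<^sup>2 else 0)"
      unfolding norm_block_map b by (rule sum.cong) (auto simp: axis_def r)
    then have "(norm (block_map a (basis_vector i)))\<^sup>2 = (frequency n a i)\<^sup>2" by simp
    then show "norm (block_map a (basis_vector i)) = frequency n a i"
      using frequency_nonneg[OF a, of i] i by (simp add: power2_eq_iff_nonneg)
    show "basis_vector i \<in> unit_sphere" by (simp add: b norm_axis_1)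
  qed
  have lower: "frequency n a (n + 1) \<le> norm (block_map a p)"
    and upper: "norm (block_map a p) \<le> frequency n a 1" if p: "p \<in> unit_sphere" for p :: "real^'d"
  proof -
    have sq: "(frequency n a (n+1))\<^sup>2 \<le> (frequency n a (idx r))\<^sup>2"
      "(frequency n a (idx r))\<^sup>2 \<le> (frequency n a 1)\<^sup>2" for r
      using frequency_antimono[OF a] frequency_nonneg[OF a] idx_range[of r]
      by (auto intro!: power_mono)
    have const: "c = (\<Sum>r\<in>UNIV. c * (p $ r)\<^sup>2)" for c :: real
      using sum_sq_unit[OF p] by (simp flip: sum_distrib_left)
    have "(frequency n a (n+1))\<^sup>2 \<le> (norm (block_map a p))\<^sup>2"
      unfolding norm_block_map by (subst const) (intro sum_mono mult_right_mono sq, simp)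
    then show "frequency n a (n+1) \<le> norm (block_map a p)"
      by (rule power2_le_imp_le) simp
    have "(norm (block_map a p))\<^sup>2 \<le> (frequency n a 1)\<^sup>2"
      unfolding norm_block_map by (subst (2) const) (intro sum_mono mult_right_mono sq, simp)
    then show "norm (block_map a p) \<le> frequency n a 1"
      by (rule power2_le_imp_le) (simp add: frequency_nonneg[OF a])
  qed
  show "(\<exists>p\<in>unit_sphere. norm (block_map a p) < c) \<longleftrightarrow> frequency n a (n + 1) < c"
  proof
    assume "\<exists>p\<in>unit_sphere. norm (block_map a p) < c"
    then show "frequency n a (n + 1) < c" using lower le_less_trans by blast
  next
    assume "frequency n a (n + 1) < c"
    then show "\<exists>p\<in>unit_sphere. norm (block_map a p) < c"
      using norm_basis[of "n + 1"] by (intro bexI[of _ "basis_vector (n + 1)"]) simp_all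
  qed
  show "(\<forall>p\<in>unit_sphere. norm (block_map a p) < c) \<longleftrightarrow> frequency n a 1 < c"
  proof
    assume "\<forall>p\<in>unit_sphere. norm (block_map a p) < c"
    moreover have "basis_vector 1 \<in> unit_sphere" by (rule norm_basis) simp
    ultimately have "norm (block_map a (basis_vector 1)) < c" by blast
    also have "norm (block_map a (basis_vector 1)) = frequency n a 1" by (rule norm_basis) simp
    finally show "frequency n a 1 < c" .
  next
    assume "frequency n a 1 < c"
    then show "\<forall>p\<in>unit_sphere. norm (block_map a p) < c" using upper le_less_trans by blast
  qed
qed

abbreviation orbit_of_tuple :: "(nat \<Rightarrow> real) \<Rightarrow> (real^'d \<Rightarrow> real^'d) set" where
  "orbit_of_tuple a \<equiv> isometry_orbit (normal_form_field idx n a)"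

lemma orbit_of_tuple_inj: "inj_on orbit_of_tuple (decreasing_nonneg_tuples (half_dim n))"
proof (rule inj_onI)
  fix a b assume ab: "a \<in> decreasing_nonneg_tuples (half_dim n)" "b \<in> decreasing_nonneg_tuples (half_dim n)"
    and "orbit_of_tuple a = orbit_of_tuple b"
  then obtain \<phi> where "orthogonal_transformation \<phi>" "\<And>x. \<phi> (block_map a x) = block_map b (\<phi> x)"
    unfolding normal_form_field_eq isometry_orbit_eq_iff[OF block_map_linear block_map_linear] by blast
  then show "a = b"
    using block_map_similar_imp_eq[OF ab] orthogonal_transformation_linear orthogonal_transformation_bij
    by blast
qed

lemma orbit_of_tuple_image:
  assumes K: "0 < K"
  shows "orbit_of_tuple ` {a \<in> decreasing_nonneg_tuples (half_dim n). frequency n a (n + 1) < sqrt K}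
    = moduli_space K"
proof (intro equalityI subsetI)
  fix C assume "C \<in> orbit_of_tuple ` {a \<in> decreasing_nonneg_tuples (half_dim n). frequency n a (n + 1) < sqrt K}"
  then show "C \<in> moduli_space K"
    unfolding moduli_space_eq[OF K] normal_form_field_eq
    using block_map_norm_bounds_iff(1) block_map_skew by blast
next
  fix C :: "(real^'d \<Rightarrow> real^'d) set" assume "C \<in> moduli_space K"
  then obtain S where C: "C = isometry_orbit (restrict S unit_sphere)" and S: "skew S"
    and ex: "\<exists>p\<in>unit_sphere. norm (S p) < sqrt K"
    unfolding moduli_space_eq[OF K] by blast
  obtain a \<phi> where a: "a \<in> decreasing_nonneg_tuples (half_dim n)" and \<phi>: "orthogonal_transformation \<phi>"
    and conj: "\<And>p. \<phi> (block_map a p) = S (\<phi> p)"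
    using skew_similar_to_block_map[OF S] by blast
  have "C = orbit_of_tuple a"
    unfolding C normal_form_field_eq
    using isometry_orbit_eq_iff[OF block_map_linear skewD(1)[OF S], of a] \<phi> conj by metis
  moreover have "\<exists>p\<in>unit_sphere. norm (block_map a p) < sqrt K"
  proof -
    obtain q where q: "q \<in> unit_sphere" "norm (S q) < sqrt K" using ex by blast
    obtain p where p: "q = \<phi> p" using orthogonal_transformation_surj[OF \<phi>] by blast
    have "norm (block_map a p) = norm (S q)" "p \<in> unit_sphere"
      using q(1) orthogonal_transformation_norm[OF \<phi>] p by (simp_all flip: conj)
    then show ?thesis using q(2) by (intro bexI[of _ p]) simp_all
  qed
  ultimately show "C \<in> orbit_of_tuple ` {a \<in> decreasing_nonneg_tuples (half_dim n). frequency n a (n + 1) < sqrt K}"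
    using block_map_norm_bounds_iff(1)[OF a] a by blast
qed

text \<open>
  The global classes form a subset of the moduli space because the last frequency is at most the
  first. Hence the second bijection is a restriction of the first.
\<close>
lemma bij_betw_moduli_space:
  assumes K: "0 < K"
  shows "bij_betw orbit_of_tuple
      {a \<in> decreasing_nonneg_tuples (half_dim n). frequency n a (n + 1) < sqrt K} (moduli_space K)"
    and "bij_betw orbit_of_tuple
      {a \<in> decreasing_nonneg_tuples (half_dim n). frequency n a 1 < sqrt K} (global_moduli_space K)"
proof -
  let ?A = "{a \<in> decreasing_nonneg_tuples (half_dim n). frequency n a (n + 1) < sqrt K}"
  let ?B = "{a \<in> decreasing_nonneg_tuples (half_dim n). frequency n a 1 < sqrt K}"
  show A: "bij_betw orbit_of_tuple ?A (moduli_space K)"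
    unfolding bij_betw_def orbit_of_tuple_image[OF K, symmetric]
    by (intro conjI refl inj_on_subset[OF orbit_of_tuple_inj]) auto
  have glob: "(\<forall>W\<in>orbit_of_tuple a. \<forall>p\<in>unit_sphere. strongly_convex_at K W p) \<longleftrightarrow> a \<in> ?B"
    if "a \<in> decreasing_nonneg_tuples (half_dim n)" for a
    unfolding normal_form_field_eq globally_convex_orbit_iff[OF K block_map_linear]
    using block_map_norm_bounds_iff(2)[OF that] that by blast
  have "?B \<subseteq> ?A"
    using frequency_antimono[of _ n 1 "n + 1"] by fastforce
  moreover have "orbit_of_tuple ` ?B = global_moduli_space K"
    unfolding global_moduli_space_def orbit_of_tuple_image[OF K, symmetric]
    using glob \<open>?B \<subseteq> ?A\<close> by blast
  ultimately show "bij_betw orbit_of_tuple ?B (global_moduli_space K)"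
    using bij_betw_subset[OF A] by blast
qed

end

theorem proposition8:
  fixes n :: nat and K :: real and idx :: "'d::finite \<Rightarrow> nat"
  assumes "n \<ge> 2" and "K > 0" and "bij_betw idx UNIV {1..n + 1}"
  shows
    "(even n \<longrightarrow>
        bij_betw (\<lambda>a. isometry_orbit (normal_form_field idx n a))
          (decreasing_nonneg_tuples (n div 2))
          (moduli_space K :: (real^'d \<Rightarrow> real^'d) set set)) \<and>
     (odd n \<longrightarrow>
        bij_betw (\<lambda>a. isometry_orbit (normal_form_field idx n a))
          {a \<in> decreasing_nonneg_tuples ((n + 1) div 2). sqrt K > a ((n + 1) div 2)}
          (moduli_space K :: (real^'d \<Rightarrow> real^'d) set set)) \<and>
     bij_betw (\<lambda>a. isometry_orbit (normal_form_field idx n a))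
       {a \<in> decreasing_nonneg_tuples (half_dim n). sqrt K > a 1}
       (global_moduli_space K :: (real^'d \<Rightarrow> real^'d) set set)"
proof -
  interpret enumerated_axes idx n by standard (rule assms(3))
  have "frequency n a 1 = a 1" for a
    using assms(1) by (simp add: frequency_def half_dim_eq)
  then have global: "{a \<in> decreasing_nonneg_tuples (half_dim n). sqrt K > a 1}
      = {a \<in> decreasing_nonneg_tuples (half_dim n). frequency n a 1 < sqrt K}" by simp
  let ?A = "{a \<in> decreasing_nonneg_tuples (half_dim n). frequency n a (n + 1) < sqrt K}"
  have even: "decreasing_nonneg_tuples (n div 2) = ?A" if "even n"
    unfolding frequency_last half_dim_def using that assms(2) by simp
  have odd: "{a \<in> decreasing_nonneg_tuples ((n + 1) div 2). sqrt K > a ((n + 1) div 2)} = ?A" if "odd n"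
    unfolding frequency_last half_dim_def using that by simp
  show ?thesis
    unfolding global
    by (intro conjI impI bij_betw_moduli_space(2)[OF assms(2)])
      (subst even, assumption, rule bij_betw_moduli_space(1)[OF assms(2)],
       subst odd, assumption, rule bij_betw_moduli_space(1)[OF assms(2)])
qed

end
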